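(* Let $L$ be a right Leibniz algebra over a field. If $L$ is dextral symmetric, then for all $x,y,z\in L$, $$[x,[y,z]]=[y,[z,x]]=[z,[x,y]]=-[x,[z,y]]=-[y,[x,z]]=-[z,[y,x]].$$
   Context: A right Leibniz algebra over a field $F$ is an $F$-vector space $L$ with a bilinear bracket $[\,,]:L\times L\to L$ satisfying $[a,[b,c]]=[[a,b],c]-[[a,c],b]$ for all $a,b,c\in L$. $L$ is dextral symmetric if for all $a,b,c\in L$, $[a,[b,c]]=0$ implies $[b,[a,c]]=0$. *)

theory Defs
  imports Complex_Main
begin

locale right_leibniz_algebra = vector_space scale
  for scale :: "'k::field \<Rightarrow> 'l::ab_group_add \<Rightarrow> 'l" +
  fixes bracket :: "'l \<Rightarrow> 'l \<Rightarrow> 'l"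
  assumes linear_bracket_left: "\<And>b. Vector_Spaces.linear scale scale (\<lambda>a. bracket a b)"
    and linear_bracket_right: "\<And>a. Vector_Spaces.linear scale scale (\<lambda>b. bracket a b)"
    and right_leibniz: "\<And>a b c.
      bracket a (bracket b c) = bracket (bracket a b) c - bracket (bracket a c) b"

definition dextral_symmetric :: "('l::zero \<Rightarrow> 'l \<Rightarrow> 'l) \<Rightarrow> bool" where
  "dextral_symmetric bracket \<longleftrightarrow>
    (\<forall>a b c. bracket a (bracket b c) = 0 \<longrightarrow> bracket b (bracket a c) = 0)"

end

theory Submission imports Defs begin

text \<open>
  The Leibniz identity alone makes \<open>[a,[b,c]]\<close> alternating in \<open>b\<close>, \<open>c\<close>. Applying dextral symmetry to
  \<open>[a,[b,b]] = 0\<close> gives \<open>[b,[a,b]] = 0\<close>, so \<open>[a,[b,c]]\<close> is also alternating in \<open>a\<close>, \<open>c\<close>; these two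
  transpositions generate all permutations.
\<close>

context right_leibniz_algebra
begin

lemma bracket_add_left: "bracket (a + b) c = bracket a c + bracket b c"
  using linear_bracket_left[of c]
  unfolding linear_iff_module_hom by (rule module_hom.add)

lemma bracket_add_right: "bracket a (b + c) = bracket a b + bracket a c"
  using linear_bracket_right[of a]
  by (simp add: linear_iff_module_hom module_hom.add)

lemma bracket_bracket_swap: "bracket a (bracket b c) = - bracket a (bracket c b)"
  by (simp add: right_leibniz)

text \<open>The two Leibniz terms coincide and cancel. Antisymmetry in \<open>b\<close>,
  \<open>c\<close> would not suffice in characteristic 2.\<close>

lemma bracket_bracket_self: "bracket a (bracket b b) = 0"
  by (simp add: right_leibniz)

lemma dextral_bracket_swap_outer:
  assumes "dextral_symmetric bracket"
  shows "bracket a (bracket b c) = - bracket c (bracket b a)"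
proof -
  have zero: "bracket u (bracket v u) = 0" for u v
    using assms bracket_bracket_self[of v u] by (auto simp: dextral_symmetric_def)
  \<comment> \<open>Polarization: expand \<open>zero\<close> at \<open>a + c\<close>; the terms with
    equal outer entries vanish, leaving the two mixed ones.\<close>
  have "bracket a (bracket b c) + bracket c (bracket b a) = 0"
    using zero[of "a + c" b] by (simp add: bracket_add_left bracket_add_right zero add.commute)
  then show ?thesis
    by (simp add: eq_neg_iff_add_eq_0)
qed

end

theorem proposition4p1:
  fixes scale :: "'k::field \<Rightarrow> 'l::ab_group_add \<Rightarrow> 'l"
    and bracket :: "'l \<Rightarrow> 'l \<Rightarrow> 'l"
    and x y z :: 'l
  assumes "right_leibniz_algebra scale bracket"
    and "dextral_symmetric bracket"
  shows "bracket x (bracket y z) = bracket y (bracket z x)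
       \<and> bracket y (bracket z x) = bracket z (bracket x y)
       \<and> bracket z (bracket x y) = - bracket x (bracket z y)
       \<and> - bracket x (bracket z y) = - bracket y (bracket x z)
       \<and> - bracket y (bracket x z) = - bracket z (bracket y x)"
proof -
  interpret right_leibniz_algebra scale bracket by fact
  note outer = dextral_bracket_swap_outer[OF assms(2)]
  \<comment> \<open>A 3-cycle is a product of two transpositions, so the two signs cancel.\<close>
  have cyclic: "bracket a (bracket b c) = bracket b (bracket c a)" for a b c
    using bracket_bracket_swap[of a b c] outer[of a c b] by simp
  show ?thesis
    using cyclic[of x y z] cyclic[of y z x] bracket_bracket_swap[of x y z]
      bracket_bracket_swap[of y z x] bracket_bracket_swap[of z x y]
    by simp
qed

end
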